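(* Let $f(n)=\sum_{i=0}^{n}\binom{n}{i}^{-1}$ for $n\in\mathbb{N}$. (a) If $k\ge1$ is an integer and $e$ is an integer with $e>\max\{1,\ j+\nu_2(j): 0<j<k\}$, then $\nu_2\bigl(f(2^e-k-1)\bigr)=k+\nu_2(k)-e$. (b) If $p$ is an odd prime which is not a Wieferich prime, $k\ge1$, and $e>\max\{1,\ 1+\nu_p(j): 0<j<k\}$, then $\nu_p\bigl(f(p^e-k-1)\bigr)=\nu_p(k)+1-e$. (c) If $p=1093$ or $p=3511$, $k\ge1$, and $e>\max\{1,\ 2+\nu_p(j):0<j<k\}$, then $\nu_p\bigl(f(p^e-k-1)\bigr)=\nu_p(k)+2-e$.
   Context: $\nu_p(x)$ denotes the exponent of the prime $p$ in a nonzero rational (or $p$-adic) number $x$. A Wieferich prime is a prime $p$ with $p^2\mid 2^{p-1}-1$. When $k=1$ the set $\{j:0<j<k\}$ is empty, so the maximum is just $1$. *)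

theory Defs
  imports Complex_Main "HOL-Computational_Algebra.Primes"
begin

definition f :: "nat \<Rightarrow> rat" where
  "f n = (\<Sum>i=0..n. inverse (of_nat (n choose i)))"

text \<open>The exponent of \<open>p\<close> in a rational number; meaningful only for prime \<open>p\<close> and \<open>x \<noteq> 0\<close>
  (by the conventions of \<open>multiplicity\<close>, the value at \<open>x = 0\<close> is \<open>0\<close>).\<close>
definition \<nu> :: "nat \<Rightarrow> rat \<Rightarrow> int" where
  "\<nu> p x = int (multiplicity (int p) (fst (quotient_of x)))
         - int (multiplicity (int p) (snd (quotient_of x)))"

definition wieferich_prime :: "nat \<Rightarrow> bool" where
  "wieferich_prime p \<longleftrightarrow> prime p \<and> p\<^sup>2 dvd 2 ^ (p - 1) - 1"

end

theory Submission
  imports Defs "HOL-Number_Theory.Pocklington" "HOL-Number_Theory.Mod_Exp"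
begin

text \<open>
  Write \<open>S m = (\<Sum>i=1..m. 2 ^ i / i)\<close>. A recurrence for inverse binomial coefficients gives
  \<open>f (m - 1) = m / 2 ^ m * S m\<close>, so with \<open>N = p ^ e\<close> everything hinges on the valuation of \<open>S (N - k)\<close>.
  The terms of \<open>S\<close> with \<open>N - k < i < N\<close> are negligible by the hypothesis on \<open>e\<close>.

  For odd \<open>p\<close>, the sum of \<open>(N choose i) / i\<close> over \<open>0 < i < N\<close> equals
  \<open>S (N - 1) - H + (2 ^ N - 2) / N\<close>, where \<open>H\<close> is the sum of \<open>1 / i\<close> over the same range. Pairing \<open>i\<close>
  with \<open>N - i\<close> shows that the left-hand side has valuation at least \<open>3 - e\<close>; so does \<open>H\<close> if \<open>p > 3\<close>
  (a Wolstenholme congruence), while \<open>2 - e\<close> is a lower bound for every odd \<open>p\<close>. Hence the valuation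
  \<open>v - e\<close> of \<open>(2 ^ N - 2) / N\<close> is also that of \<open>S (N - 1)\<close>, where \<open>v\<close> is the valuation of
  \<open>2 ^ (p - 1) - 1\<close>: it is 1 for non-Wieferich primes and 2 for 1093 and 3511.

  For \<open>p = 2\<close>, \<open>f (N - 1)\<close> is a sum of \<open>2 ^ e\<close> inverses of odd numbers, so \<open>S N\<close> has valuation greater
  than \<open>N - e\<close>, and the term \<open>2 ^ N / N\<close> of \<open>S N\<close> dominates.
\<close>

section \<open>Calculus of p-adic valuations of rationals\<close>

text \<open>\<open>val_ge p n x\<close> includes \<open>x = 0\<close>, unlike an inequality for \<open>\<nu> p x\<close>.\<close>

definition val_ge :: "nat \<Rightarrow> int \<Rightarrow> rat \<Rightarrow> bool" where
  "val_ge p n x \<longleftrightarrow>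
    (\<exists>a b. \<not> int p dvd b \<and> x = of_nat p powi n * of_int a / of_int b)"

text \<open>Any representation with \<open>a\<close> and \<open>b\<close> prime to \<open>p\<close>
  is allowed, reduced or not, so that products and sums can be formed directly. For prime
  \<open>p\<close> the condition on \<open>a\<close> forces \<open>x\<close> to be nonzero.\<close>

definition val_eq :: "nat \<Rightarrow> int \<Rightarrow> rat \<Rightarrow> bool" where
  "val_eq p n x \<longleftrightarrow>
    (\<exists>a b. \<not> int p dvd a \<and> \<not> int p dvd b \<and> x = of_nat p powi n * of_int a / of_int b)"

lemma val_eq_imp_ge: "val_eq p n x \<Longrightarrow> val_ge p n x"
  unfolding val_eq_def val_ge_def by blast

context
  fixes p :: nat
  assumes prime_p: "prime p"
begin

lemma not_dvd_mult_p: "\<not> int p dvd a \<Longrightarrow> \<not> int p dvd b \<Longrightarrow> \<not> int p dvd a * b"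
  using prime_p by (simp add: prime_dvd_mult_iff)

lemma not_dvd_p_nonzero: "\<not> int p dvd a \<Longrightarrow> a \<noteq> 0"
  by auto

lemma p_rat_nonzero: "(of_nat p :: rat) \<noteq> 0"
  using prime_p by (auto simp: prime_gt_0_nat)

lemma one_not_dvd_p: "\<not> int p dvd 1"
  using prime_gt_1_nat[OF prime_p] by simp

lemma val_eq_p_power: "val_eq p n (of_nat p powi n)"
  unfolding val_eq_def using one_not_dvd_p
  by (intro exI[of _ 1]) simp

lemma val_ge_0: "val_ge p n 0"
  unfolding val_ge_def using one_not_dvd_p
  by (intro exI[of _ 0] exI[of _ 1]) simp

lemma val_ge_of_int: "val_ge p 0 (of_int a)"
  unfolding val_ge_def using one_not_dvd_p
  by (intro exI[of _ a] exI[of _ 1]) simp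

lemma val_ge_of_nat: "val_ge p 0 (of_nat a)"
  using val_ge_of_int[of "int a"] by simp

lemma val_ge_mult:
  assumes "val_ge p m x" "val_ge p n y"
  shows "val_ge p (m + n) (x * y)"
proof -
  obtain a b where 1: "\<not> int p dvd b" "x = of_nat p powi m * of_int a / of_int b"
    using assms(1) unfolding val_ge_def by blast
  obtain c d where 2: "\<not> int p dvd d" "y = of_nat p powi n * of_int c / of_int d"
    using assms(2) unfolding val_ge_def by blast
  show ?thesis unfolding val_ge_def
    using 1 2 not_dvd_mult_p[OF 1(1) 2(1)] p_rat_nonzero
    by (intro exI[of _ "a * c"] exI[of _ "b * d"]) (simp add: power_int_add)
qed

lemma val_eq_mult:
  assumes "val_eq p m x" "val_eq p n y"
  shows "val_eq p (m + n) (x * y)"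
proof -
  obtain a b where 1: "\<not> int p dvd a" "\<not> int p dvd b" "x = of_nat p powi m * of_int a / of_int b"
    using assms(1) unfolding val_eq_def by blast
  obtain c d where 2: "\<not> int p dvd c" "\<not> int p dvd d" "y = of_nat p powi n * of_int c / of_int d"
    using assms(2) unfolding val_eq_def by blast
  show ?thesis unfolding val_eq_def
    using 1 2 not_dvd_mult_p[OF 1(2) 2(2)] not_dvd_mult_p[OF 1(1) 2(1)] p_rat_nonzero
    by (intro exI[of _ "a * c"] exI[of _ "b * d"]) (simp add: power_int_add)
qed

lemma val_eq_inverse:
  assumes "val_eq p n x"
  shows "val_eq p (- n) (inverse x)"
proof -
  obtain a b where 1: "\<not> int p dvd a" "\<not> int p dvd b" "x = of_nat p powi n * of_int a / of_int b"
    using assms unfolding val_eq_def by blast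
  show ?thesis unfolding val_eq_def
    using 1 by (intro exI[of _ b] exI[of _ a]) (simp add: power_int_minus field_simps)
qed

lemma val_eq_divide:
  assumes "val_eq p m x" "val_eq p n y"
  shows "val_eq p (m - n) (x / y)"
  using val_eq_mult[OF assms(1) val_eq_inverse[OF assms(2)]] by (simp add: divide_inverse)

text \<open>Write \<open>p powi n\<close> as \<open>p powi m\<close> times the integer
  \<open>p ^ nat (n - m)\<close> and absorb the latter into the numerator.\<close>

lemma val_ge_mono:
  assumes "val_ge p n x" "m \<le> n"
  shows "val_ge p m x"
proof -
  have "val_ge p (m + 0) (of_nat p powi m * (of_nat (p ^ nat (n - m)) * (x / of_nat p powi n)))"
  proof (intro val_ge_mult val_eq_imp_ge[OF val_eq_p_power])
    have "val_ge p 0 (x / of_nat p powi n)"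
      using val_ge_mult[OF assms(1) val_eq_imp_ge[OF val_eq_inverse[OF val_eq_p_power[of n]]]]
      by (simp add: divide_inverse)
    from val_ge_mult[OF val_ge_of_nat[of "p ^ nat (n - m)"] this]
    show "val_ge p 0 (of_nat (p ^ nat (n - m)) * (x / of_nat p powi n))" by simp
  qed
  moreover have "of_nat p powi n = (of_nat p powi m * of_nat p ^ nat (n - m) :: rat)"
    using assms(2) p_rat_nonzero power_int_add[of "of_nat p :: rat" m "n - m"]
    by (simp add: power_int_def)
  ultimately show ?thesis
    using p_rat_nonzero by (simp add: field_simps)
qed

lemma val_ge_add:
  assumes "val_ge p n x" "val_ge p n y"
  shows "val_ge p n (x + y)"
proof -
  obtain a b where 1: "\<not> int p dvd b" "x = of_nat p powi n * of_int a / of_int b"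
    using assms(1) unfolding val_ge_def by blast
  obtain c d where 2: "\<not> int p dvd d" "y = of_nat p powi n * of_int c / of_int d"
    using assms(2) unfolding val_ge_def by blast
  show ?thesis unfolding val_ge_def
    using 1 2 not_dvd_mult_p[OF 1(1) 2(1)] not_dvd_p_nonzero
    by (intro exI[of _ "a * d + c * b"] exI[of _ "b * d"]) (auto simp: field_simps)
qed

lemma val_ge_uminus: "val_ge p n x \<Longrightarrow> val_ge p n (- x)"
  using val_ge_mult[OF val_ge_of_int[of "-1"], of n x] by simp

lemma val_ge_diff: "val_ge p n x \<Longrightarrow> val_ge p n y \<Longrightarrow> val_ge p n (x - y)"
  using val_ge_add[of n x "- y"] val_ge_uminus by simp

lemma val_ge_sum: "(\<And>i. i \<in> A \<Longrightarrow> val_ge p n (g i)) \<Longrightarrow> val_ge p n (sum g A)"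
  by (induction A rule: infinite_finite_induct) (auto intro: val_ge_0 val_ge_add)

text \<open>The strict case of the ultrametric inequality: over the common denominator
  \<open>b * d\<close> the numerator is congruent to \<open>a * d\<close> modulo \<open>p\<close>,
  hence prime to \<open>p\<close>.\<close>

lemma val_eq_add:
  assumes "val_eq p n x" "val_ge p (n + 1) y"
  shows "val_eq p n (x + y)"
proof -
  obtain a b where 1: "\<not> int p dvd a" "\<not> int p dvd b" "x = of_nat p powi n * of_int a / of_int b"
    using assms(1) unfolding val_eq_def by blast
  obtain c d where 2: "\<not> int p dvd d" "y = of_nat p powi (n + 1) * of_int c / of_int d"
    using assms(2) unfolding val_ge_def by blast
  have "\<not> int p dvd a * d + int p * (c * b)"
    using not_dvd_mult_p[OF 1(1) 2(1)] by (metis dvd_add_left_iff dvd_triv_left)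
  then show ?thesis unfolding val_eq_def
    using 1 2 not_dvd_mult_p[OF 1(2) 2(1)] not_dvd_p_nonzero p_rat_nonzero
    by (intro exI[of _ "a * d + int p * (c * b)"] exI[of _ "b * d"])
       (auto simp: field_simps power_int_add)
qed

lemma val_eq_of_int: "\<not> int p dvd a \<Longrightarrow> val_eq p 0 (of_int a)"
  unfolding val_eq_def using one_not_dvd_p
  by (intro exI[of _ a] exI[of _ 1]) simp

lemma val_eq_of_nat:
  assumes "j > 0"
  shows "val_eq p (int (multiplicity p j)) (of_nat j)"
proof -
  obtain u where u: "j = p ^ multiplicity p j * u" "\<not> p dvd u"
    using assms prime_gt_1_nat[OF prime_p] multiplicity_decompose'[of j p] by auto
  have "val_eq p (int (multiplicity p j) + 0) (of_nat p powi int (multiplicity p j) * of_int (int u))"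
    using u(2) by (intro val_eq_mult val_eq_p_power val_eq_of_int) simp
  moreover have "of_nat j = (of_nat p ^ multiplicity p j * of_nat u :: rat)"
    using u(1) by (metis of_nat_mult of_nat_power)
  ultimately show ?thesis by simp
qed

text \<open>Cross-multiplying the given fraction with \<open>quotient_of x\<close> yields an
  equation between integers, on which multiplicities of \<open>p\<close> can be compared.\<close>

lemma val_eq_imp_nu:
  assumes "val_eq p n x"
  shows "\<nu> p x = n"
proof -
  obtain a b where 1: "\<not> int p dvd a" "\<not> int p dvd b" "x = of_nat p powi n * of_int a / of_int b"
    using assms unfolding val_eq_def by blast
  obtain c d where q: "quotient_of x = (c, d)" by fastforce
  have d: "d > 0" and x: "x = of_int c / of_int d"
    using q quotient_of_denom_pos quotient_of_div by auto
  have nz: "a \<noteq> 0" "b \<noteq> 0" using 1 by auto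
  have "x \<noteq> 0" using 1 nz p_rat_nonzero by simp
  then have c: "c \<noteq> 0" using x by auto
  have pe: "prime_elem (int p)" using prime_p by simp
  have m0: "multiplicity (int p) a = 0" "multiplicity (int p) b = 0"
    using 1 by (auto simp: not_dvd_imp_multiplicity_0)
  have pw: "multiplicity (int p) (int p ^ t) = t" for t
    using prime_gt_1_nat[OF prime_p] by (simp add: multiplicity_same_power')
  have pnz: "int p \<noteq> 0" using prime_p by auto
  show ?thesis
  \<comment> \<open>The sign of \<open>n\<close> decides on which side of the integer equation the
    power of \<open>p\<close> stands.\<close>
  proof (cases "n \<ge> 0")
    case True
    then obtain t where t: "n = int t" using nonneg_int_cases by blast
    have "of_int (c * b) = (of_int (int p ^ t * a * d) :: rat)"
      using 1(3) x nz d by (simp add: t field_simps)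
    then have "c * b = int p ^ t * a * d" by (simp only: of_int_eq_iff)
    then have "multiplicity (int p) (c * b) = multiplicity (int p) (int p ^ t * a * d)" by simp
    then have "multiplicity (int p) c = t + multiplicity (int p) d"
      using nz c d pe m0 pnz by (simp add: prime_elem_multiplicity_mult_distrib pw)
    then show ?thesis unfolding \<nu>_def using q t by simp
  next
    case False
    then have t: "n = - int (nat (- n))" by simp
    define t where "t = nat (- n)"
    note t = t[folded t_def]
    have "of_int (c * b * int p ^ t) = (of_int (a * d) :: rat)"
      using 1(3) x nz d p_rat_nonzero by (simp add: t power_int_minus field_simps)
    then have "c * b * int p ^ t = a * d" by (simp only: of_int_eq_iff)
    then have "multiplicity (int p) (c * b * int p ^ t) = multiplicity (int p) (a * d)" by simp
    then have "multiplicity (int p) c + t = multiplicity (int p) d"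
      using nz c d pe m0 pnz by (simp add: prime_elem_multiplicity_mult_distrib pw)
    then show ?thesis unfolding \<nu>_def using q t by simp
  qed
qed

lemma nu_of_nat: "j > 0 \<Longrightarrow> \<nu> p (of_nat j) = int (multiplicity p j)"
  by (rule val_eq_imp_nu[OF val_eq_of_nat])

section \<open>Numbers and binomial coefficients below a prime power\<close>

lemma multiplicity_less:
  assumes "0 < i" "i < p ^ e"
  shows "multiplicity p i < e"
  using assms multiplicity_dvd[of p i] prime_p
  by (metis dvd_imp_le dvd_trans le_imp_power_dvd linorder_not_less)

lemma val_ge_p_power_nat: "val_ge p (int e) (of_nat (p ^ e))"
  using val_eq_imp_ge[OF val_eq_p_power[of "int e"]] by simp

lemma val_ge_inverse_less:
  assumes "0 < i" "i < p ^ e"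
  shows "val_ge p (1 - int e) (1 / of_nat i)"
proof -
  have "val_ge p (- int (multiplicity p i)) (1 / of_nat i)"
    using val_eq_imp_ge[OF val_eq_inverse[OF val_eq_of_nat[OF assms(1)]]]
    by (simp add: divide_inverse)
  then show ?thesis
    by (rule val_ge_mono) (use multiplicity_less[OF assms] in simp)
qed

text \<open>The valuation of \<open>j\<close> is below \<open>e\<close>, so \<open>p ^ e\<close> is
  negligible against \<open>j\<close>.\<close>

lemma val_eq_prime_power_minus:
  assumes "0 < j" "j < p ^ e"
  shows "val_eq p (int (multiplicity p j)) (of_nat (p ^ e - j))"
proof -
  have "val_eq p (int (multiplicity p j)) (- of_nat j + of_nat (p ^ e))"
  proof (rule val_eq_add)
    show "val_eq p (int (multiplicity p j)) (- of_nat j)"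
      using val_eq_mult[OF val_eq_of_int[of "-1"] val_eq_of_nat[OF assms(1)]] one_not_dvd_p by simp
    show "val_ge p (int (multiplicity p j) + 1) (of_nat (p ^ e))"
      by (rule val_ge_mono[OF val_ge_p_power_nat]) (use multiplicity_less[OF assms] in simp)
  qed
  then show ?thesis using assms by (simp add: of_nat_diff)
qed

text \<open>By absorption the coefficient is \<open>p ^ e / i\<close> times an integer, and
  \<open>i\<close> carries at most \<open>e - 1\<close> factors \<open>p\<close>.\<close>

lemma val_ge_choose_prime_power:
  assumes "0 < i" "i < p ^ e"
  shows "val_ge p 1 (of_nat ((p ^ e) choose i))"
proof -
  have "i * ((p ^ e) choose i) = p ^ e * ((p ^ e - 1) choose (i - 1))"
    using assms by (metis binomial_absorption Suc_diff_1)
  then have "of_nat i * of_nat ((p ^ e) choose i)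
      = (of_nat (p ^ e) * of_nat ((p ^ e - 1) choose (i - 1)) :: rat)"
    by (metis of_nat_mult)
  then have "of_nat ((p ^ e) choose i)
      = (of_nat (p ^ e) * of_nat ((p ^ e - 1) choose (i - 1)) * (1 / of_nat i) :: rat)"
    using assms by (simp add: field_simps)
  moreover have "val_ge p (int e + 0 + (1 - int e)) \<dots>"
    by (intro val_ge_mult val_ge_p_power_nat val_ge_of_nat val_ge_inverse_less assms)
  ultimately show ?thesis by simp
qed

text \<open>Serves to remove the unit factors 2 and -3 that arise when a sum is compared with a
  rearrangement of itself.\<close>

lemma val_ge_cancel: "val_eq p 0 c \<Longrightarrow> val_ge p n (c * x) \<Longrightarrow> val_ge p n x"
proof -
  assume c: "val_eq p 0 c" and cx: "val_ge p n (c * x)"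
  have "c \<noteq> 0" using c not_dvd_p_nonzero p_rat_nonzero unfolding val_eq_def by auto
  with val_ge_mult[OF val_eq_imp_ge[OF val_eq_inverse[OF c]] cx] show "val_ge p n x"
    by (simp add: field_simps)
qed

lemma val_eq_two: "odd p \<Longrightarrow> val_eq p 0 2"
proof -
  assume "odd p"
  then have "\<not> p dvd 2"
    using prime_p by (metis primes_dvd_imp_eq two_is_prime_nat even_zero dvd_refl)
  then show ?thesis using val_eq_of_int[of 2]
    by (metis int_dvd_int_iff of_int_numeral of_nat_numeral)
qed

section \<open>Harmonic sums and Wolstenholme congruences\<close>

text \<open>Adding the sum to its reflection under \<open>i\<close> to \<open>N - i\<close> gives
  twice the sum, and 2 is a unit for odd \<open>p\<close>.\<close>

lemma val_ge_pairing:
  fixes N :: nat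
  assumes "odd p" and g: "\<And>i. 0 < i \<Longrightarrow> i < N \<Longrightarrow> val_ge p n (g i + g (N - i))"
  shows "val_ge p n (\<Sum>i=1..<N. g i)"
proof (rule val_ge_cancel[OF val_eq_two[OF assms(1)]])
  have "(\<Sum>i=1..<N. g i) = (\<Sum>i=1..<N. g (N - i))"
    by (rule sum.reindex_bij_witness[of _ "\<lambda>i. N - i" "\<lambda>i. N - i"]) (simp_all, linarith+)
  then have "2 * (\<Sum>i=1..<N. g i) = (\<Sum>i=1..<N. g i + g (N - i))"
    by (simp add: sum.distrib)
  also have "val_ge p n \<dots>" by (intro val_ge_sum g) auto
  finally show "val_ge p n (2 * (\<Sum>i=1..<N. g i))" .
qed

text \<open>The factor \<open>N\<close> on the right is the gain from pairing: for
  \<open>N = p ^ e\<close> it contributes \<open>e\<close> to the valuation.\<close>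

lemma inverse_add_reflect:
  assumes "0 < i" "i < N"
  shows "1 / of_nat i + 1 / of_nat (N - i) = (of_nat N * (1 / of_nat i) * (1 / of_nat (N - i)) :: rat)"
proof -
  have "of_nat (N - i) = (of_nat N - of_nat i :: rat)" "of_nat (N - i) \<noteq> (0 :: rat)"
    using assms by (simp_all add: of_nat_diff)
  then show ?thesis using assms by (simp add: field_simps)
qed

lemma val_ge_harmonic:
  assumes "odd p"
  shows "val_ge p (2 - int e) (\<Sum>i=1..<p ^ e. 1 / of_nat i)"
proof (rule val_ge_pairing[OF assms])
  fix i assume i: "0 < i" "i < p ^ e"
  have "val_ge p (int e + (1 - int e) + (1 - int e))
      (of_nat (p ^ e) * (1 / of_nat i) * (1 / of_nat (p ^ e - i)))"
    using i by (intro val_ge_mult val_ge_p_power_nat val_ge_inverse_less) auto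
  then show "val_ge p (2 - int e) (1 / of_nat i + 1 / of_nat (p ^ e - i))"
    using inverse_add_reflect[OF i] by simp
qed

text \<open>The two binomial coefficients of a pair agree, so each pair is a paired reciprocal times
  a multiple of \<open>p\<close>; this improves the harmonic bound \<open>2 - e\<close> by
  one.\<close>

lemma val_ge_sum_choose_div:
  assumes "odd p"
  shows "val_ge p (3 - int e) (\<Sum>i=1..<p ^ e. of_nat ((p ^ e) choose i) / of_nat i)"
proof (rule val_ge_pairing[OF assms])
  fix i assume i: "0 < i" "i < p ^ e"
  have "val_ge p (1 + (int e + (1 - int e) + (1 - int e)))
      (of_nat ((p ^ e) choose i) * (of_nat (p ^ e) * (1 / of_nat i) * (1 / of_nat (p ^ e - i))))"
    using i by (intro val_ge_mult val_ge_p_power_nat val_ge_inverse_less val_ge_choose_prime_power) auto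
  moreover have "(p ^ e) choose (p ^ e - i) = (p ^ e) choose i"
    using i by (simp add: binomial_symmetric[of i])
  moreover have "of_nat ((p ^ e) choose i) / of_nat i + of_nat ((p ^ e) choose i) / of_nat (p ^ e - i)
      = (of_nat ((p ^ e) choose i) * (1 / of_nat i + 1 / of_nat (p ^ e - i)) :: rat)"
    by (simp add: distrib_left)
  ultimately show "val_ge p (3 - int e) (of_nat ((p ^ e) choose i) / of_nat i
      + of_nat ((p ^ e) choose (p ^ e - i)) / of_nat (p ^ e - i))"
    using inverse_add_reflect[OF i] by simp
qed

text \<open>Doubling permutes the nonzero residues modulo \<open>p ^ e\<close>, so the sum is almost a quarter of itself.\<close>

lemma val_ge_sum_inverse_squares:
  assumes "odd p" "p > 3"
  shows "val_ge p (3 - 2 * int e) (\<Sum>i=1..<p ^ e. (1 / of_nat i)\<^sup>2)"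
proof (rule val_ge_cancel)
  define N where "N = p ^ e"
  define r where "r i = 2 * i mod N" for i
  \<comment> \<open>The factor \<open>-3 = 1 - 4\<close> comes from subtracting four times the
    permuted sum from the sum itself; it is a unit because \<open>p > 3\<close>.\<close>
  have "\<not> p dvd 3"
    using assms prime_p by (auto dest: dvd_imp_le)
  then have "\<not> int p dvd -3"
    by (metis dvd_minus_iff int_dvd_int_iff of_nat_numeral)
  then show "val_eq p 0 (-3)" using val_eq_of_int[of "-3"] by simp
  have N: "N > 0" using prime_p by (simp add: N_def prime_gt_0_nat)
  have cop: "coprime N 2" using assms(1) by (simp add: N_def)
  have ran: "r i \<in> {1..<N}" if "i \<in> {1..<N}" for i
  proof -
    have "\<not> N dvd i" using that by (auto dest: dvd_imp_le)
    then have "\<not> N dvd 2 * i" using cop by (simp add: coprime_dvd_mult_right_iff)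
    then show ?thesis using N by (auto simp: r_def dvd_eq_mod_eq_0 Suc_le_eq)
  qed
  have inj: "inj_on r {1..<N}"
  proof (rule inj_onI)
    fix i j assume ij: "i \<in> {1..<N}" "j \<in> {1..<N}" "r i = r j"
    then have "[2 * i = 2 * j] (mod N)" by (simp add: r_def cong_def)
    then have "[i = j] (mod N)" using cop by (simp add: cong_mult_lcancel_nat coprime_commute)
    then show "i = j" using ij by (simp add: cong_def)
  qed
  have bij: "r ` {1..<N} = {1..<N}"
    using ran inj by (intro endo_inj_surj) auto
  have "(\<Sum>i=1..<N. (1 / of_nat i)\<^sup>2) = (\<Sum>i\<in>r ` {1..<N}. (1 / of_nat i)\<^sup>2 :: rat)"
    using bij by simp
  also have "\<dots> = (\<Sum>i=1..<N. (1 / of_nat (r i))\<^sup>2)"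
    by (subst sum.reindex[OF inj]) (simp add: o_def)
  finally have "-3 * (\<Sum>i=1..<N. (1 / of_nat i)\<^sup>2)
      = (\<Sum>i=1..<N. (1 / of_nat i)\<^sup>2 - 4 * (1 / of_nat (r i))\<^sup>2 :: rat)"
    by (simp add: sum_subtractf flip: sum_distrib_left)
  also have "val_ge p (3 - 2 * int e) \<dots>"
  proof (rule val_ge_sum)
    fix i assume i: "i \<in> {1..<N}"
    have ri: "r i \<in> {1..<N}" using ran i .
    define q where "q = 2 * i div N"
    have "2 * i = N * q + r i" by (simp add: q_def r_def)
    then have "2 * of_nat i = (of_nat N * of_nat q + of_nat (r i) :: rat)"
      by (metis of_nat_add of_nat_mult of_nat_numeral)
    then have d: "of_nat (r i) - 2 * of_nat i = (of_nat N * of_int (- int q) :: rat)"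
      by simp
    have I: "val_ge p (1 - int e) (1 / of_nat i)" "val_ge p (1 - int e) (1 / of_nat (r i))"
      using i ri by (auto intro!: val_ge_inverse_less simp: N_def)
    have nz: "of_nat i \<noteq> (0 :: rat)" "of_nat (r i) \<noteq> (0 :: rat)" using i ri by auto
    \<comment> \<open>With \<open>x = 1 / i\<close> and \<open>y = 1 / r i\<close> this is
      \<open>(x - 2 * y) * (x + 2 * y)\<close>. The first factor contains
      \<open>r i - 2 * i\<close>, a multiple of \<open>N\<close>, which supplies the valuation
      \<open>e\<close>.\<close>
    have "(1 / of_nat i)\<^sup>2 - 4 * (1 / of_nat (r i))\<^sup>2
        = ((of_nat (r i) - 2 * of_nat i) * (1 / of_nat i) * (1 / of_nat (r i)))
          * (1 / of_nat i + (1 / of_nat (r i) + 1 / of_nat (r i)) :: rat)"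
      using nz by (simp add: field_simps power2_eq_square)
    also have "val_ge p (int e + 0 + (1 - int e) + (1 - int e) + (1 - int e)) \<dots>"
      unfolding d N_def
      by (intro val_ge_mult val_ge_add I val_ge_p_power_nat val_ge_of_int)
    finally show "val_ge p (3 - 2 * int e) ((1 / of_nat i)\<^sup>2 - 4 * (1 / of_nat (r i))\<^sup>2)"
      by simp
  qed
  finally show "val_ge p (3 - 2 * int e) (-3 * (\<Sum>i=1..<p ^ e. (1 / of_nat i)\<^sup>2))"
    by (simp add: N_def)
qed

text \<open>Pairing is applied to \<open>2 / i + N / i ^ 2\<close> with \<open>N = p ^ e\<close>:
  the correction term makes each pair equal to \<open>N\<close> times the square of a paired
  reciprocal, of valuation at least \<open>4 - e\<close>. The correction sums to
  \<open>N * Q\<close>, which the bound on inverse squares controls.\<close>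

lemma val_ge_harmonic_strong:
  assumes "odd p" "p > 3"
  shows "val_ge p (3 - int e) (\<Sum>i=1..<p ^ e. 1 / of_nat i)"
proof -
  define H where "H = (\<Sum>i=1..<p ^ e. 1 / of_nat i :: rat)"
  define Q where "Q = (\<Sum>i=1..<p ^ e. (1 / of_nat i)\<^sup>2 :: rat)"
  have "val_ge p (3 - int e) (\<Sum>i=1..<p ^ e. 2 * (1 / of_nat i) + of_nat (p ^ e) * (1 / of_nat i)\<^sup>2)"
  proof (rule val_ge_pairing[OF assms(1)])
    fix i assume i: "0 < i" "i < p ^ e"
    define a b where "a = (1 / of_nat i :: rat)" and "b = (1 / of_nat (p ^ e - i) :: rat)"
    have "val_ge p (1 - int e) a" "val_ge p (1 - int e) b"
      unfolding a_def b_def using i by (intro val_ge_inverse_less; simp)+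
    then have "val_ge p (int e + (1 - int e) + (1 - int e)) (of_nat (p ^ e) * a * b)"
      by (intro val_ge_mult val_ge_p_power_nat)
    moreover have r: "a + b = of_nat (p ^ e) * a * b"
      using inverse_add_reflect[OF i] by (simp only: a_def b_def)
    ultimately have "val_ge p (2 - int e) (a + b)" by simp
    then have "val_ge p (int e + ((2 - int e) + (2 - int e))) (of_nat (p ^ e) * ((a + b) * (a + b)))"
      by (intro val_ge_mult val_ge_p_power_nat)
    \<comment> \<open>The mixed term \<open>2 * N * a * b\<close> of the square, where
      \<open>N = p ^ e\<close>, is \<open>2 * (a + b)\<close> by the reflection identity.\<close>
    also have "of_nat (p ^ e) * ((a + b) * (a + b))
        = 2 * (of_nat (p ^ e) * a * b) + of_nat (p ^ e) * a\<^sup>2 + of_nat (p ^ e) * b\<^sup>2"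
      by (simp add: algebra_simps power2_eq_square)
    also have "\<dots> = 2 * a + of_nat (p ^ e) * a\<^sup>2 + (2 * b + of_nat (p ^ e) * b\<^sup>2)"
      unfolding r[symmetric] by simp
    finally have "val_ge p (4 - int e) (2 * a + of_nat (p ^ e) * a\<^sup>2 + (2 * b + of_nat (p ^ e) * b\<^sup>2))"
      by simp
    then show "val_ge p (3 - int e) (2 * (1 / of_nat i) + of_nat (p ^ e) * (1 / of_nat i)\<^sup>2
        + (2 * (1 / of_nat (p ^ e - i)) + of_nat (p ^ e) * (1 / of_nat (p ^ e - i))\<^sup>2))"
      unfolding a_def b_def by (rule val_ge_mono) simp
  qed
  then have "val_ge p (3 - int e) (2 * H + of_nat (p ^ e) * Q)"
    by (simp only: H_def Q_def sum.distrib sum_distrib_left)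
  moreover have "val_ge p (int e + (3 - 2 * int e)) (of_nat (p ^ e) * Q)"
    unfolding Q_def by (intro val_ge_mult val_ge_p_power_nat val_ge_sum_inverse_squares assms)
  ultimately have "val_ge p (3 - int e) (2 * H)"
    using val_ge_diff[of "3 - int e" "2 * H + of_nat (p ^ e) * Q" "of_nat (p ^ e) * Q"] by simp
  then show ?thesis unfolding H_def by (rule val_ge_cancel[OF val_eq_two[OF assms(1)]])
qed

section \<open>Lifting the exponent\<close>

text \<open>With \<open>x = 2 ^ (p - 1)\<close> and \<open>p ^ e = 1 + (p - 1) * M\<close>, the
  number is \<open>2 * (x - 1) * (\<Sum>i<M. x ^ i)\<close>. Since \<open>x\<close> is congruent to
  1 modulo \<open>p\<close>, the last factor is congruent to \<open>M\<close>.\<close>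

lemma val_eq_two_power_prime_power:
  assumes "odd p" and v: "val_eq p v (2 ^ (p - 1) - 1)" "v \<ge> 1" and e: "e > 0"
  shows "val_eq p v (2 ^ (p ^ e) - 2)"
proof -
  define x where "x = (2 ^ (p - 1) :: rat)"
  define M where "M = (\<Sum>i<e. p ^ i)"
  have p1: "p > 1" using prime_gt_1_nat[OF prime_p] .
  have "int (p ^ e) - 1 = (int p - 1) * int M"
    unfolding M_def using power_diff_1_eq[of "int p" e] by simp
  then have "int (p ^ e) = int (Suc ((p - 1) * M))"
    using p1 by (simp add: of_nat_diff)
  then have pe: "p ^ e = Suc ((p - 1) * M)" by (simp only: of_nat_eq_iff)
  \<comment> \<open>As \<open>e > 0\<close>, the geometric sum \<open>M\<close> starts with 1 and is
    congruent to 1 modulo \<open>p\<close>, hence a unit.\<close>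
  obtain e' where "e = Suc e'" using e by (cases e) auto
  then have M: "M = 1 + p * (\<Sum>i<e'. p ^ i)"
    unfolding M_def by (simp add: sum.lessThan_Suc_shift sum_distrib_left del: sum.lessThan_Suc)
  have x: "val_eq p v (x - 1)" using v by (simp add: x_def)
  then have x1: "val_ge p 1 (x - 1)" using val_eq_imp_ge val_ge_mono v(2) by blast
  have "val_ge p 1 (x ^ i - 1)" for i
  proof -
    have "val_ge p 0 (\<Sum>j<i. x ^ j)"
      using val_ge_of_nat[of "\<Sum>j<i. (2 ^ (p - 1)) ^ j"] by (simp add: x_def)
    from val_ge_mult[OF x1 this] show ?thesis
      by (simp only: power_diff_1_eq) simp
  qed
  then have "val_ge p 1 (\<Sum>i<M. x ^ i - 1)" by (intro val_ge_sum)
  moreover have "val_eq p 0 (of_nat M)"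
  proof -
    have "\<not> p dvd M" unfolding M using p1 by (metis dvd_add_left_iff dvd_triv_left nat_dvd_1_iff_1 less_irrefl)
    then show ?thesis using val_eq_of_int[of "int M"] by simp
  qed
  ultimately have "val_eq p 0 (of_nat M + (\<Sum>i<M. x ^ i - 1))"
    by (intro val_eq_add) simp_all
  then have "val_eq p 0 (\<Sum>i<M. x ^ i)" by (simp add: sum_subtractf)
  then have "val_eq p (0 + (v + 0)) (2 * ((x - 1) * (\<Sum>i<M. x ^ i)))"
    by (intro val_eq_mult val_eq_two x assms)
  also have "2 * ((x - 1) * (\<Sum>i<M. x ^ i)) = 2 * (x ^ M - 1)"
    by (simp only: power_diff_1_eq)
  also have "\<dots> = 2 ^ (p ^ e) - 2"
    unfolding pe x_def by (simp add: power_mult[symmetric])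
  finally show ?thesis by simp
qed

end

section \<open>Exact identities for \<open>f\<close> and for the sums of
  \<open>2 ^ i / i\<close>\<close>

text \<open>Inverses of neighbours in row \<open>n + 1\<close> add up to
  \<open>(n + 2) / (n + 1)\<close> times the inverse of the entry above them. Over the whole row
  this counts every entry twice except the two outer ones, which are 1 and account for the summand
  2.\<close>

lemma f_Suc: "2 * f (Suc n) = 2 + of_nat (n + 2) / of_nat (n + 1) * f n"
proof -
  have *: "inverse (of_nat (Suc n choose i)) + inverse (of_nat (Suc n choose Suc i))
      = (of_nat (n + 2) / of_nat (n + 1) * inverse (of_nat (n choose i)) :: rat)" if "i \<le> n" for i
  proof -
    have c: "n choose i > 0" "Suc n choose i > 0" "Suc n choose Suc i > 0" using that by auto
    have "(Suc n - i) * (Suc n choose i) = Suc n * (n choose i)"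
      using binomial_absorb_comp[of "Suc n" i] by simp
    then have "(of_nat (Suc n) - of_nat i) * of_nat (Suc n choose i)
        = (of_nat (Suc n) * of_nat (n choose i) :: rat)"
      using that by (metis of_nat_diff of_nat_mult le_SucI)
    then have 1: "inverse (of_nat (Suc n choose i))
        = ((of_nat (Suc n) - of_nat i) / (of_nat (Suc n) * of_nat (n choose i)) :: rat)"
      using c by (simp add: field_simps del: of_nat_Suc binomial_Suc_Suc)
    have "of_nat (Suc i) * of_nat (Suc n choose Suc i) = (of_nat (Suc n) * of_nat (n choose i) :: rat)"
      by (metis of_nat_mult Suc_times_binomial_eq mult.commute)
    then have 2: "inverse (of_nat (Suc n choose Suc i))
        = (of_nat (Suc i) / (of_nat (Suc n) * of_nat (n choose i)) :: rat)"
      using c by (simp add: field_simps del: of_nat_Suc binomial_Suc_Suc)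
    show ?thesis unfolding 1 2 by (simp add: add_divide_distrib[symmetric] field_simps)
  qed
  have "2 * f (Suc n) = (\<Sum>i=0..n. inverse (of_nat (Suc n choose i))) + 1
      + (1 + (\<Sum>i=0..n. inverse (of_nat (Suc n choose Suc i))))"
    unfolding mult_2 f_def
    by (subst (2) sum.atLeast0_atMost_Suc_shift, subst sum.atLeast0_atMost_Suc) (simp add: o_def)
  also have "\<dots> = 2 + (\<Sum>i=0..n. inverse (of_nat (Suc n choose i)) + inverse (of_nat (Suc n choose Suc i)))"
    by (simp only: sum.distrib)
  also have "(\<Sum>i=0..n. inverse (of_nat (Suc n choose i)) + inverse (of_nat (Suc n choose Suc i)))
      = of_nat (n + 2) / of_nat (n + 1) * f n"
    unfolding f_def sum_distrib_left by (rule sum.cong[OF refl], rule *) simp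
  finally show ?thesis .
qed

text \<open>By the recurrence, \<open>2 ^ (n + 1) / (n + 1) * f n\<close> grows by
  \<open>2 ^ (n + 2) / (n + 2)\<close> when \<open>n\<close> increases by one.\<close>

lemma f_eq: "f n = of_nat (n + 1) / 2 ^ (n + 1) * (\<Sum>i=1..n + 1. 2 ^ i / of_nat i)"
proof (induction n)
  case 0
  show ?case by (simp add: f_def)
next
  case (Suc n)
  define s where "s = (\<Sum>i=1..n + 1. 2 ^ i / of_nat i :: rat)"
  define a b c where "a = (of_nat (n + 1) :: rat)" and "b = (of_nat (n + 2) :: rat)"
    and "c = (2 ^ (n + 1) :: rat)"
  define t where "t = (\<Sum>i=1..Suc n + 1. 2 ^ i / of_nat i :: rat)"
  have t: "t = s + 2 * c / b"
    by (simp add: s_def t_def c_def b_def)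
  have f_n: "f n = a / c * s"
    using Suc.IH by (simp only: s_def a_def c_def)
  have nz: "a \<noteq> 0" "b \<noteq> 0" "c \<noteq> 0"
    by (simp_all only: a_def b_def c_def of_nat_eq_0_iff) simp_all
  have "2 * f (Suc n) = 2 + b / a * f n"
    using f_Suc[of n] by (simp only: a_def b_def)
  then have "f (Suc n) = (2 + b / a * (a / c * s)) / 2"
    unfolding f_n by simp
  then have "f (Suc n) = b / (2 * c) * t"
    unfolding t using nz by (simp add: field_simps)
  then show ?case by (simp add: b_def c_def t_def)
qed

text \<open>Pascal's rule and absorption give \<open>(m + 1 choose i) / i = (m choose i) / i + (m +
  1 choose i) / (m + 1)\<close>; the second terms sum to the new term on the right.\<close>

lemma sum_choose_div:
  "(\<Sum>i=1..m. of_nat (m choose i) / of_nat i) = (\<Sum>j=1..m. (2 ^ j - 1) / of_nat j :: rat)"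
proof (induction m)
  case 0
  show ?case by simp
next
  case (Suc m)
  have "(\<Sum>i=1..Suc m. of_nat (Suc m choose i) / of_nat i :: rat)
      = (\<Sum>i=1..Suc m. of_nat (m choose i) / of_nat i + of_nat (Suc m choose i) / of_nat (Suc m))"
  proof (rule sum.cong[OF refl])
    fix i assume "i \<in> {1..Suc m}"
    then obtain j where j: "i = Suc j" by (cases i) auto
    have "of_nat (Suc j) * of_nat (Suc m choose Suc j) = (of_nat (Suc m) * of_nat (m choose j) :: rat)"
      by (metis of_nat_mult Suc_times_binomial_eq mult.commute)
    then have "of_nat (Suc m choose Suc j) / of_nat (Suc m) = (of_nat (m choose j) / of_nat (Suc j) :: rat)"
      by (simp add: field_simps del: of_nat_Suc binomial_Suc_Suc)
    then show "of_nat (Suc m choose i) / of_nat i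
        = (of_nat (m choose i) / of_nat i + of_nat (Suc m choose i) / of_nat (Suc m) :: rat)"
      unfolding j by (simp only: binomial_Suc_Suc of_nat_add add_divide_distrib add.commute)
  qed
  \<comment> \<open>The term \<open>i = Suc m\<close> of the first sum drops out since
    \<open>m choose Suc m\<close> is 0.\<close>
  also have "\<dots> = (\<Sum>i=1..m. of_nat (m choose i) / of_nat i)
      + (\<Sum>i=1..Suc m. of_nat (Suc m choose i)) / of_nat (Suc m)"
    by (simp only: sum.distrib sum_divide_distrib) simp
  also have "(\<Sum>i=1..Suc m. of_nat (Suc m choose i)) = (2 ^ Suc m - 1 :: rat)"
  proof -
    have "(\<Sum>i\<le>Suc m. of_nat (Suc m choose i) :: rat) = 2 ^ Suc m"
      by (metis choose_row_sum of_nat_sum of_nat_power of_nat_numeral)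
    then show ?thesis
      by (simp only: atMost_atLeast0 sum.atLeast_Suc_atMost[of 0] le0) (simp add: algebra_simps)
  qed
  finally show ?case using Suc.IH by simp
qed

text \<open>The top terms are indexed by their distance \<open>j < k\<close> from \<open>N\<close>,
  the range about which the hypothesis on \<open>e\<close> speaks.\<close>

lemma sum_split_top:
  fixes g :: "nat \<Rightarrow> rat"
  assumes "1 \<le> k" "k < N"
  shows "(\<Sum>i=1..<N. g i) = (\<Sum>i=1..N - k. g i) + (\<Sum>j=1..<k. g (N - j))"
proof -
  have "(\<Sum>i=1..<N. g i) = (\<Sum>i=1..<Suc (N - k). g i) + (\<Sum>i=Suc (N - k)..<N. g i)"
    using assms by (intro sum.atLeastLessThan_concat[symmetric]) simp_all
  also have "(\<Sum>i=Suc (N - k)..<N. g i) = (\<Sum>j=1..<k. g (N - j))"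
    by (rule sum.reindex_bij_witness[of _ "\<lambda>j. N - j" "\<lambda>j. N - j"]) (use assms in auto)
  finally show ?thesis by (simp only: atLeastLessThanSuc_atLeastAtMost)
qed

text \<open>Splitting off the terms at \<open>N\<close> in \<open>sum_choose_div\<close> leaves
  \<open>1 / N\<close> on one side and \<open>(2 ^ N - 1) / N\<close> on the other, whence
  \<open>(2 ^ N - 2) / N\<close>.\<close>

lemma sum_two_power_div:
  assumes "N > 0"
  shows "(\<Sum>i=1..<N. 2 ^ i / of_nat i :: rat) = - ((2 ^ N - 2) / of_nat N)
    + ((\<Sum>i=1..<N. of_nat (N choose i) / of_nat i) + (\<Sum>i=1..<N. 1 / of_nat i))"
proof -
  have "{1..N} = insert N {1..<N}" using assms by auto
  then show ?thesis using sum_choose_div[of N] assms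
    by (simp add: diff_divide_distrib sum_subtractf)
qed

section \<open>Valuation of \<open>f\<close> at odd primes\<close>

context
  fixes p :: nat
  assumes prime_p: "prime p"
begin

text \<open>Treats parts (b) and (c) together. All terms other than \<open>(2 ^ N - 2) / N\<close>
  must have valuation at least \<open>v - e + 1\<close>: for \<open>v = 1\<close> the plain harmonic
  bound is enough, also at \<open>p = 3\<close>, while \<open>v = 2\<close> calls on the strong one
  and thus on \<open>p > 3\<close>.\<close>

lemma val_eq_f_odd:
  assumes odd: "odd p" and v: "val_eq p v (2 ^ (p - 1) - 1)" "v = 1 \<or> v = 2 \<and> p > 3"
    and k: "k \<ge> 1" and e: "e > 1"
    and j: "\<And>j. 0 < j \<Longrightarrow> j < k \<Longrightarrow> v + int (multiplicity p j) < int e"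
  shows "val_eq p (int (multiplicity p k) + v - int e) (f (p ^ e - k - 1))"
proof -
  define N where "N = p ^ e"
  have p1: "p > 1" using prime_gt_1_nat[OF prime_p] .
  have v1: "v \<ge> 1" using v(2) by auto
  have kN: "k < N"
  \<comment> \<open>Otherwise \<open>j = p ^ (e - 1)\<close> lies below \<open>k\<close>, and the
    hypothesis would give \<open>v + (e - 1) < e\<close>, against \<open>v \<ge> 1\<close>.\<close>
  proof (rule ccontr)
    assume "\<not> k < N"
    moreover have "p ^ (e - 1) < N" using e p1 by (simp add: N_def power_strict_increasing)
    ultimately have "v + int (multiplicity p (p ^ (e - 1))) < int e"
      using p1 by (intro j) auto
    then show False using p1 v1 e by (simp add: multiplicity_same_power)
  qed
  define R where "R = (\<Sum>j=1..<k. 2 ^ (N - j) / of_nat (N - j) :: rat)"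
  have S: "(\<Sum>i=1..<N. 2 ^ i / of_nat i) = (\<Sum>i=1..N - k. 2 ^ i / of_nat i) + R"
    unfolding R_def by (rule sum_split_top) (use k kN in auto)
  have "val_ge p (v - int e + 1) R"
    unfolding R_def
  proof (rule val_ge_sum[OF prime_p])
    fix i assume i: "i \<in> {1..<k}"
    \<comment> \<open>\<open>N - i\<close> has the valuation of \<open>i\<close>, so the hypothesis
      on \<open>e\<close> makes this term negligible.\<close>
    have "val_eq p (int (multiplicity p i)) (of_nat (N - i))"
      unfolding N_def using i kN by (intro val_eq_prime_power_minus prime_p) (auto simp: N_def)
    from val_ge_mult[OF prime_p val_ge_of_nat[OF prime_p, of "2 ^ (N - i)"]
        val_eq_imp_ge[OF val_eq_inverse[OF prime_p this]]]
    have "val_ge p (- int (multiplicity p i)) (2 ^ (N - i) / of_nat (N - i))"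
      by (simp add: divide_inverse)
    then show "val_ge p (v - int e + 1) (2 ^ (N - i) / of_nat (N - i))"
      by (rule val_ge_mono[OF prime_p]) (use j[of i] i in auto)
  qed
  moreover have "val_ge p (v - int e + 1) ((\<Sum>i=1..<N. of_nat (N choose i) / of_nat i)
      + (\<Sum>i=1..<N. 1 / of_nat i))"
  proof (rule val_ge_add[OF prime_p])
    show "val_ge p (v - int e + 1) (\<Sum>i=1..<N. of_nat (N choose i) / of_nat i)"
      unfolding N_def using v(2)
      by (intro val_ge_mono[OF prime_p val_ge_sum_choose_div[OF prime_p odd]]) auto
    show "val_ge p (v - int e + 1) (\<Sum>i=1..<N. 1 / of_nat i)"
      using v(2) val_ge_harmonic[OF prime_p odd, of e] val_ge_harmonic_strong[OF prime_p odd, of e]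
      by (auto simp: N_def)
  qed
  ultimately have "val_ge p (v - int e + 1) ((\<Sum>i=1..<N. of_nat (N choose i) / of_nat i)
      + (\<Sum>i=1..<N. 1 / of_nat i) - R)"
    by (intro val_ge_diff[OF prime_p])
  moreover have "val_eq p (v - int e) (- ((2 ^ N - 2) / of_nat N))"
  proof -
    have "val_eq p v (2 ^ N - 2)"
      unfolding N_def using e by (intro val_eq_two_power_prime_power[OF prime_p odd v(1) v1]) simp
    moreover have "val_eq p (int e) (of_nat N)"
      using val_eq_p_power[OF prime_p, of "int e"] by (simp add: N_def)
    ultimately have "val_eq p (0 + (v - int e)) (of_int (-1) * ((2 ^ N - 2) / of_nat N))"
      by (intro val_eq_mult[OF prime_p] val_eq_divide[OF prime_p] val_eq_of_int[OF prime_p])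
         (use one_not_dvd_p[OF prime_p] in simp_all)
    then show ?thesis by (simp only: of_int_minus of_int_1 mult_minus1 add_0)
  qed
  ultimately have "val_eq p (v - int e) (- ((2 ^ N - 2) / of_nat N)
      + ((\<Sum>i=1..<N. of_nat (N choose i) / of_nat i) + (\<Sum>i=1..<N. 1 / of_nat i) - R))"
    by (rule val_eq_add[OF prime_p, rotated])
  moreover have "(\<Sum>i=1..N - k. 2 ^ i / of_nat i) = - ((2 ^ N - 2) / of_nat N)
      + ((\<Sum>i=1..<N. of_nat (N choose i) / of_nat i) + (\<Sum>i=1..<N. 1 / of_nat i) - R)"
    using S sum_two_power_div[of N] kN by simp
  ultimately have main: "val_eq p (v - int e) (\<Sum>i=1..N - k. 2 ^ i / of_nat i)" by simp
  have "val_eq p (int (multiplicity p k)) (of_nat (N - k))"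
    unfolding N_def using k kN by (intro val_eq_prime_power_minus prime_p) (auto simp: N_def)
  moreover have "val_eq p 0 (2 ^ n)" for n
  proof (induction n)
    case 0
    show ?case using val_eq_of_int[OF prime_p one_not_dvd_p[OF prime_p]] by simp
  next
    case (Suc n)
    with val_eq_mult[OF prime_p val_eq_two[OF prime_p odd]] show ?case by fastforce
  qed
  ultimately have "val_eq p (int (multiplicity p k) - 0 + (v - int e))
      (of_nat (N - k) / 2 ^ (N - k) * (\<Sum>i=1..N - k. 2 ^ i / of_nat i))"
    by (intro val_eq_mult[OF prime_p] val_eq_divide[OF prime_p] main)
  moreover have "N - k - 1 + 1 = N - k" using kN by simp
  ultimately show ?thesis
    using f_eq[of "N - k - 1"] by (simp only: N_def add_diff_eq diff_zero)
qed

end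

section \<open>Valuation of \<open>f\<close> at the prime 2\<close>

lemma val_eq_two_odd_diff:
  assumes "val_eq 2 0 x"
  shows "val_ge 2 1 (x - 1)"
proof -
  obtain a b :: int where 1: "odd a" "odd b" "x = of_int a / of_int b"
    using assms unfolding val_eq_def by auto
  have "even (a - b)" using 1 by simp
  then obtain c where "a - b = 2 * c" by blast
  then have "(of_int a - of_int b :: rat) = 2 * of_int c" by (metis of_int_diff of_int_mult of_int_numeral)
  moreover have "b \<noteq> 0" using 1 by auto
  ultimately have "x - 1 = of_nat 2 powi 1 * of_int c / of_int b" using 1 by (simp add: field_simps)
  then show ?thesis unfolding val_ge_def using 1(2) by (intro exI[of _ c] exI[of _ b]) simp
qed

text \<open>The inner entries of row \<open>2 ^ e\<close> are even, so by Pascal's rule neighbours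
  in the row before have equal parity; the first entry is 1.\<close>

lemma val_eq_choose_pred:
  assumes "i < 2 ^ e"
  shows "val_eq 2 0 (of_nat ((2 ^ e - 1) choose i))"
  using assms
proof (induction i)
  case 0
  show ?case using val_eq_of_int[of 2 1] by simp
next
  case (Suc i)
  have "Suc (2 ^ e - 1) choose Suc i = ((2 ^ e - 1) choose i) + ((2 ^ e - 1) choose Suc i)"
    by (rule binomial_Suc_Suc)
  then have "of_nat ((2 ^ e - 1) choose Suc i)
      = (- of_nat ((2 ^ e - 1) choose i) + of_nat ((2 ^ e) choose Suc i) :: rat)"
    by simp
  moreover have "val_eq 2 0 (- of_nat ((2 ^ e - 1) choose i))"
    using val_eq_mult[OF two_is_prime_nat val_eq_of_int[OF two_is_prime_nat, of "-1"], of 0] Suc by simp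
  moreover have "val_ge 2 (0 + 1) (of_nat ((2 ^ e) choose Suc i))"
    using val_ge_choose_prime_power[OF two_is_prime_nat] Suc.prems by simp
  ultimately show ?case
    by (simp only: val_eq_add[OF two_is_prime_nat])
qed

text \<open>Each of the \<open>2 ^ e\<close> summands is congruent to 1 modulo 2, and their number
  is even.\<close>

lemma val_ge_f_pred:
  assumes "e > 0"
  shows "val_ge 2 1 (f (2 ^ e - 1))"
proof -
  let ?N = "2 ^ e :: nat"
  note p2 = two_is_prime_nat
  have "f (?N - 1) = (\<Sum>i=0..?N - 1. inverse (of_nat ((?N - 1) choose i)) - 1) + of_nat ?N"
    by (simp add: f_def sum_subtractf)
  also have "val_ge 2 1 \<dots>"
  proof (intro val_ge_add[OF p2] val_ge_sum[OF p2] val_eq_two_odd_diff)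
    fix i assume "i \<in> {0..?N - 1}"
    then have "i < 2 ^ e" by (simp add: Suc_le_eq le_diff_conv2)
    from val_eq_inverse[OF p2 val_eq_choose_pred[OF this]]
    show "val_eq 2 0 (inverse (of_nat ((?N - 1) choose i)))" by simp
  next
    show "val_ge 2 1 (of_nat ?N)"
      by (rule val_ge_mono[OF p2 val_ge_p_power_nat[OF p2]]) (use assms in simp)
  qed
  finally show ?thesis .
qed

text \<open>The hypothesis \<open>j + multiplicity 2 j < e\<close> says that
  \<open>2 ^ (N - j) / (N - j)\<close> has valuation above \<open>N - e\<close>. The full sum up to
  \<open>N\<close> does as well, so the sum up to \<open>N - k\<close> must cancel
  \<open>2 ^ N / N\<close> to leading order.\<close>

lemma val_eq_f_two:
  assumes k: "k \<ge> 1" and e: "e > 1"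
    and j: "\<And>j. 0 < j \<Longrightarrow> j < k \<Longrightarrow> j + multiplicity 2 j < e"
  shows "val_eq 2 (int k + int (multiplicity 2 k) - int e) (f (2 ^ e - k - 1))"
proof -
  note p2 = two_is_prime_nat
  define N where "N = (2 ^ e :: nat)"
  \<comment> \<open>For \<open>k > 1\<close> the instance \<open>j = k - 1\<close> already gives
    \<open>k - 1 < e\<close>.\<close>
  have ke: "k \<le> e" using j[of "k - 1"] k e by (cases "k = 1") auto
  have eN: "e < N" unfolding N_def by (rule less_exp)
  have kN: "k < N" using ke eN by simp
  have p2N: "val_eq 2 (int n) (2 ^ n)" for n
    using val_eq_p_power[OF p2, of "int n"] by simp
  define R where "R = (\<Sum>j=1..<k. 2 ^ (N - j) / of_nat (N - j) :: rat)"
  have S: "(\<Sum>i=1..N. 2 ^ i / of_nat i)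
      = 2 ^ N / of_nat N + ((\<Sum>i=1..N - k. 2 ^ i / of_nat i) + R)"
  proof -
    have "{1..N} = insert N {1..<N}" using kN by auto
    then show ?thesis
      using sum_split_top[of k N "\<lambda>i. 2 ^ i / of_nat i :: rat"] k kN by (simp add: R_def)
  qed
  have R: "val_ge 2 (int N - int e + 1) R"
    unfolding R_def
  proof (rule val_ge_sum[OF p2])
    fix i assume i: "i \<in> {1..<k}"
    have "val_eq 2 (int (multiplicity 2 i)) (of_nat (N - i))"
      unfolding N_def using i kN by (intro val_eq_prime_power_minus p2) (auto simp: N_def)
    from val_eq_imp_ge[OF val_eq_divide[OF p2 p2N[of "N - i"] this]]
    show "val_ge 2 (int N - int e + 1) (2 ^ (N - i) / of_nat (N - i))"
      by (rule val_ge_mono[OF p2]) (use j[of i] i kN in auto)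
  qed
  have N2: "val_eq 2 (int e) (of_nat N)"
    using p2N[of e] by (simp add: N_def)
  \<comment> \<open>The closed form of \<open>f\<close> is read backwards here, turning the evenness
    of \<open>f (N - 1)\<close> into a bound for the sum up to \<open>N\<close>.\<close>
  have "val_ge 2 (1 + (int N - int e)) (f (N - 1) * (2 ^ N / of_nat N))"
    using e unfolding N_def
    by (intro val_ge_mult[OF p2] val_ge_f_pred val_eq_imp_ge val_eq_divide[OF p2]
        p2N N2[unfolded N_def]) simp
  also have "f (N - 1) * (2 ^ N / of_nat N) = (\<Sum>i=1..N. 2 ^ i / of_nat i)"
    using f_eq[of "N - 1"] kN by simp
  finally have SN: "val_ge 2 (int N - int e + 1) (\<Sum>i=1..N. 2 ^ i / of_nat i)"
    by (simp only: add.commute)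
  have "val_eq 2 (0 + (int N - int e)) (of_int (-1) * (2 ^ N / of_nat N))"
    by (intro val_eq_mult[OF p2] val_eq_of_int[OF p2] val_eq_divide[OF p2] p2N N2) simp
  then have "val_eq 2 (int N - int e) (- (2 ^ N / of_nat N))" by simp
  from val_eq_add[OF p2 this val_ge_diff[OF p2 SN R]]
  have main: "val_eq 2 (int N - int e) (\<Sum>i=1..N - k. 2 ^ i / of_nat i)"
    using S by simp
  have "val_eq 2 (int (multiplicity 2 k)) (of_nat (N - k))"
    unfolding N_def using k kN by (intro val_eq_prime_power_minus p2) (auto simp: N_def)
  then have "val_eq 2 (int (multiplicity 2 k) - int (N - k) + (int N - int e))
      (of_nat (N - k) / 2 ^ (N - k) * (\<Sum>i=1..N - k. 2 ^ i / of_nat i))"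
    by (intro val_eq_mult[OF p2] val_eq_divide[OF p2] main p2N)
  \<comment> \<open>Division by \<open>2 ^ (N - k)\<close> replaces the valuation
    \<open>N - e\<close> by \<open>k - e\<close>, the source of the summand \<open>k\<close> in the
    result.\<close>
  moreover have "N - k - 1 + 1 = N - k"
    "int (multiplicity 2 k) - int (N - k) + (int N - int e) = int k + int (multiplicity 2 k) - int e"
    using kN by simp_all
  ultimately show ?thesis
    using f_eq[of "N - k - 1"] by (simp only: N_def)
qed

section \<open>Reading the bound on \<open>e\<close>; valuation of
  \<open>2 ^ (p - 1) - 1\<close>\<close>

lemma Max_bound_iff:
  fixes h :: "nat \<Rightarrow> int"
  shows "x > Max (insert 1 {h j | j. 0 < j \<and> j < k}) \<longleftrightarrow> x > 1 \<and> (\<forall>j. 0 < j \<and> j < k \<longrightarrow> x > h j)"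
proof -
  \<comment> \<open>As the image of a finite interval the set is finite, so \<open>Max\<close> is a
    genuine maximum.\<close>
  have "{h j | j. 0 < j \<and> j < k} = h ` {0<..<k}" by auto
  then show ?thesis by auto
qed

lemma val_eq_of_dvd:
  assumes "prime p" "a = int p ^ n * b" "\<not> int p dvd b"
  shows "val_eq p (int n) (of_int a)"
  using val_eq_mult[OF assms(1) val_eq_p_power[OF assms(1), of "int n"] val_eq_of_int[OF assms(1,3)]] assms(2)
  by simp

text \<open>Fermat's theorem gives one factor \<open>p\<close>; a second one would make
  \<open>p\<close> a Wieferich prime.\<close>

lemma val_eq_fermat_quotient:
  assumes "prime p" "odd p" "\<not> wieferich_prime p"
  shows "val_eq p 1 (2 ^ (p - 1) - 1)"
proof -
  have "\<not> p dvd 2"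
    using assms(1,2) by (metis primes_dvd_imp_eq two_is_prime_nat even_zero dvd_refl)
  then have "[2 ^ (p - 1) = 1] (mod p)" using fermat_theorem assms(1) by blast
  then have "p dvd 2 ^ (p - 1) - 1" by (simp add: cong_altdef_nat)
  then obtain b where b: "2 ^ (p - 1) - 1 = p * b" by blast
  have "\<not> p dvd b"
    using assms(1,3) b unfolding wieferich_prime_def by (auto simp: power2_eq_square)
  moreover have "(2 :: int) ^ (p - 1) - 1 = int p * int b"
    using arg_cong[OF b, of int] by (simp add: of_nat_diff)
  ultimately have "val_eq p (int 1) (of_int (2 ^ (p - 1) - 1))"
    using val_eq_of_dvd[OF assms(1), of "2 ^ (p - 1) - 1" 1 "int b"] by simp
  then show ?thesis by simp
qed

text \<open>A residue \<open>1 + p ^ 2 * b\<close> modulo \<open>p ^ 3\<close> with \<open>b\<close>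
  prime to \<open>p\<close> determines the valuation. The exponent, modulus and residue are separate
  variables so that they can be given as numerals and \<open>mod_exp\<close> evaluated.\<close>

lemma val_eq_fermat_quotient_mod_cube:
  assumes "prime p" "p - 1 = n" "mod_exp 2 n m = r"
    and "m = int p ^ 3" "r = 1 + int p ^ 2 * b" "\<not> int p dvd b"
  shows "val_eq p 2 (2 ^ (p - 1) - 1)"
proof -
  have "2 ^ (p - 1) = int p ^ 3 * (2 ^ (p - 1) div int p ^ 3) + (1 + int p ^ 2 * b)"
    using assms(2-5) mult_div_mod_eq[of "int p ^ 3" "2 ^ (p - 1)"] by (simp add: mod_exp_def)
  then have "2 ^ (p - 1) - 1 = int p ^ 2 * (int p * (2 ^ (p - 1) div int p ^ 3) + b)"
    by (simp add: power2_eq_square power3_eq_cube algebra_simps)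
  moreover have "\<not> int p dvd int p * (2 ^ (p - 1) div int p ^ 3) + b"
    using assms(6) by (metis dvd_add_right_iff dvd_triv_left)
  ultimately have "val_eq p (int 2) (of_int (2 ^ (p - 1) - 1))"
    by (rule val_eq_of_dvd[OF assms(1)])
  then show ?thesis by simp
qed

text \<open>A composite \<open>n\<close> has a divisor \<open>d > 1\<close> with
  \<open>d\<^sup>2 \<le> n\<close>, and such a \<open>d\<close> is below \<open>b\<close>.\<close>

lemma prime_by_trial_division:
  fixes n :: nat
  assumes "n > 1" "n < b\<^sup>2" "list_all (\<lambda>d. n mod d \<noteq> 0) [2..<b]"
  shows "prime n"
  unfolding prime_divisor_sqrt
proof (intro conjI allI impI)
  fix d assume d: "d dvd n \<and> d\<^sup>2 \<le> n"
  then have "d < b" using assms(2) power_less_imp_less_base[of d 2 b] by simp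
  moreover have "n mod d = 0" "d \<noteq> 0" using d assms(1) by (auto intro!: gr0I)
  moreover have "\<forall>x\<in>{2..<b}. n mod x \<noteq> 0"
    using assms(3) unfolding list_all_iff set_upt .
  ultimately have "\<not> d \<ge> 2" "d \<noteq> 0"
    by (meson atLeastLessThan_iff)+
  then show "d = 1" by linarith
qed (use assms(1) in simp)

lemma prime_1093: "prime (1093 :: nat)"
  \<comment> \<open>34 is the least number whose square exceeds 1093, as 60 is for 3511.\<close>
  by (rule prime_by_trial_division[where b = 34]) (simp_all add: upt_rec[of "numeral _"])

lemma prime_3511: "prime (3511 :: nat)"
  by (rule prime_by_trial_division[where b = 60]) (simp_all add: upt_rec[of "numeral _"])

lemma val_eq_fermat_quotient_wieferich:
  assumes "p = 1093 \<or> p = 3511"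
  shows "val_eq p 2 (2 ^ (p - 1) - 1)"
  using assms
proof
  assume p: "p = 1093"
  \<comment> \<open>Here \<open>m\<close> is \<open>1093 ^ 3\<close>, \<open>r\<close> the residue
    of \<open>2 ^ 1092\<close> modulo \<open>m\<close>, and \<open>b = (r - 1) / 1093 ^ 2\<close>;
    the numerals for 3511 arise in the same way.\<close>
  show ?thesis unfolding p
    by (rule val_eq_fermat_quotient_mod_cube[OF prime_1093,
        where n = 1092 and m = 1305751357 and r = 581794064 and b = 487]) simp_all
next
  assume p: "p = 3511"
  show ?thesis unfolding p
    by (rule val_eq_fermat_quotient_mod_cube[OF prime_3511,
        where n = 3510 and m = 43280521831 and r = 628683172 and b = 51]) simp_all
qed

theorem theorem1p2:
  "(\<forall>k e :: nat. k \<ge> 1 \<longrightarrow>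
      int e > Max (insert 1 {int j + \<nu> 2 (of_nat j) | j. 0 < j \<and> j < k}) \<longrightarrow>
      \<nu> 2 (f (2 ^ e - k - 1)) = int k + \<nu> 2 (of_nat k) - int e)
   \<and> (\<forall>p k e :: nat. prime p \<longrightarrow> odd p \<longrightarrow> \<not> wieferich_prime p \<longrightarrow> k \<ge> 1 \<longrightarrow>
      int e > Max (insert 1 {1 + \<nu> p (of_nat j) | j. 0 < j \<and> j < k}) \<longrightarrow>
      \<nu> p (f (p ^ e - k - 1)) = \<nu> p (of_nat k) + 1 - int e)
   \<and> (\<forall>p k e :: nat. p = 1093 \<or> p = 3511 \<longrightarrow> k \<ge> 1 \<longrightarrow>
      int e > Max (insert 1 {2 + \<nu> p (of_nat j) | j. 0 < j \<and> j < k}) \<longrightarrow>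
      \<nu> p (f (p ^ e - k - 1)) = \<nu> p (of_nat k) + 2 - int e)"
proof (intro conjI allI impI)
  fix k e :: nat
  assume k: "k \<ge> 1" and "int e > Max (insert 1 {int j + \<nu> 2 (of_nat j) | j. 0 < j \<and> j < k})"
  then have *: "int e > 1" "\<And>j. 0 < j \<Longrightarrow> j < k \<Longrightarrow> int e > int j + \<nu> 2 (of_nat j)"
    unfolding Max_bound_iff by auto
  have "val_eq 2 (int k + int (multiplicity 2 k) - int e) (f (2 ^ e - k - 1))"
  proof (rule val_eq_f_two[OF k])
    show "e > 1" using *(1) by simp
    show "j + multiplicity 2 j < e" if "0 < j" "j < k" for j
      using *(2)[OF that] nu_of_nat[OF two_is_prime_nat that(1)] by simp
  qed
  from val_eq_imp_nu[OF two_is_prime_nat this]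
  show "\<nu> 2 (f (2 ^ e - k - 1)) = int k + \<nu> 2 (of_nat k) - int e"
    using nu_of_nat[OF two_is_prime_nat, of k] k by simp
next
  fix p k e :: nat
  assume p: "prime p" "odd p" "\<not> wieferich_prime p" and k: "k \<ge> 1"
    and "int e > Max (insert 1 {1 + \<nu> p (of_nat j) | j. 0 < j \<and> j < k})"
  then have *: "int e > 1" "\<And>j. 0 < j \<Longrightarrow> j < k \<Longrightarrow> int e > 1 + \<nu> p (of_nat j)"
    unfolding Max_bound_iff by auto
  have "val_eq p (int (multiplicity p k) + 1 - int e) (f (p ^ e - k - 1))"
  proof (rule val_eq_f_odd[OF p(1,2) val_eq_fermat_quotient[OF p] _ k])
    show "e > 1" using *(1) by simp
    show "1 + int (multiplicity p j) < int e" if "0 < j" "j < k" for j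
      using *(2)[OF that] nu_of_nat[OF p(1) that(1)] by simp
  qed simp
  from val_eq_imp_nu[OF p(1) this]
  show "\<nu> p (f (p ^ e - k - 1)) = \<nu> p (of_nat k) + 1 - int e"
    using nu_of_nat[OF p(1), of k] k by simp
next
  fix p k e :: nat
  assume p: "p = 1093 \<or> p = 3511" and k: "k \<ge> 1"
    and "int e > Max (insert 1 {2 + \<nu> p (of_nat j) | j. 0 < j \<and> j < k})"
  then have *: "int e > 1" "\<And>j. 0 < j \<Longrightarrow> j < k \<Longrightarrow> int e > 2 + \<nu> p (of_nat j)"
    unfolding Max_bound_iff by auto
  have "prime p"
    using p prime_1093 prime_3511 by metis
  moreover have "odd p" "p > 3" using p by auto
  ultimately have p': "prime p" "odd p" "p > 3" .
  have "val_eq p (int (multiplicity p k) + 2 - int e) (f (p ^ e - k - 1))"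
  proof (rule val_eq_f_odd[OF p'(1,2) val_eq_fermat_quotient_wieferich[OF p] _ k])
    show "e > 1" using *(1) by simp
    show "2 + int (multiplicity p j) < int e" if "0 < j" "j < k" for j
      using *(2)[OF that] nu_of_nat[OF p'(1) that(1)] by simp
  qed (use p'(3) in simp)
  from val_eq_imp_nu[OF p'(1) this]
  show "\<nu> p (f (p ^ e - k - 1)) = \<nu> p (of_nat k) + 2 - int e"
    using nu_of_nat[OF p'(1), of k] k by simp
qed

end
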